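(* Let $N$ be a finite ground set, $f:2^N\to\mathbb{R}$ monotone submodular with $f(\emptyset)=0$, $k\geq 4$ an integer, and suppose every element of $N$ has a copy in $N$. Let $a_1,\dots,a_{k-2}$ be the first $k-2$ elements chosen by the greedy algorithm on $N$, let $a_1',a_2'$ be copies of $a_1,a_2$, and let $A=\{a_1,a_1',a_2,a_2',a_3,\dots,a_{k-2}\}$ (the 2-Copy algorithm). Then $$g_1(A)\geq \beta\Big(0,\tfrac{k-5}{k-1}\Big)\, g_1(OPT(k,N,1)),$$ and $\beta(0,\frac{k-5}{k-1})\to 1-1/e$ as $k\to\infty$.
   Context: An element $x'\neq x$ is a copy of $x$ if $f(\{x'\})=f(\{x\})$ and $f(\{x,x'\})-f(\{x\})=0$. The greedy algorithm on $N$ chooses $a_i\in\arg\max_{x\in N\setminus\{a_1,\dots,a_{i-1}\}} \big(f(\{a_1,\dots,a_{i-1},x\})-f(\{a_1,\dots,a_{i-1}\})\big)$, ties broken arbitrarily. $g_1(A)=\min_{Z\subseteq A,|Z|\leq 1} f(A\setminus Z)$; $OPT(k,N,1)$ is a maximizer of $g_1$ over subsets of $N$ of size at most $k$. $\beta(0,\alpha)=1-e^{-\alpha}$. *)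

theory Defs
  imports Complex_Main
begin

definition submodular_on :: "'a set \<Rightarrow> ('a set \<Rightarrow> real) \<Rightarrow> bool" where
  "submodular_on N f \<longleftrightarrow>
     (\<forall>A\<in>Pow N. \<forall>B\<in>Pow N. f (A \<union> B) + f (A \<inter> B) \<le> f A + f B)"

text \<open>\<open>is_copy f x x'\<close> reads: \<open>x'\<close> is a copy of \<open>x\<close>.\<close>
definition is_copy :: "('a set \<Rightarrow> real) \<Rightarrow> 'a \<Rightarrow> 'a \<Rightarrow> bool" where
  "is_copy f x x' \<longleftrightarrow> x' \<noteq> x \<and> f {x'} = f {x} \<and> f {x, x'} - f {x} = 0"

text \<open>The sequence is indexed from 1. Ties are broken arbitrarily: the predicate holds of every
  sequence that some tie-breaking can produce.\<close>
definition greedy_seq :: "'a set \<Rightarrow> ('a set \<Rightarrow> real) \<Rightarrow> nat \<Rightarrow> (nat \<Rightarrow> 'a) \<Rightarrow> bool" where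
  "greedy_seq N f m a \<longleftrightarrow>
     (\<forall>i\<in>{1..m}. is_arg_max (\<lambda>x. f (insert x (a ` {1..<i})) - f (a ` {1..<i}))
                            (\<lambda>x. x \<in> N - a ` {1..<i}) (a i))"

definition robust_value :: "nat \<Rightarrow> ('a set \<Rightarrow> real) \<Rightarrow> 'a set \<Rightarrow> real" where
  "robust_value \<tau> f A = Min ((\<lambda>Z. f (A - Z)) ` {Z. Z \<subseteq> A \<and> card Z \<le> \<tau>})"

text \<open>\<open>is_OPT f k N \<tau> S\<close> says that \<open>S\<close> is a possible choice of \<open>OPT(k, N, \<tau>)\<close>.\<close>
definition is_OPT :: "('a set \<Rightarrow> real) \<Rightarrow> nat \<Rightarrow> 'a set \<Rightarrow> nat \<Rightarrow> 'a set \<Rightarrow> bool" where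
  "is_OPT f k N \<tau> S \<longleftrightarrow> is_arg_max (robust_value \<tau> f) (\<lambda>S. S \<subseteq> N \<and> card S \<le> k) S"

text \<open>\<open>beta0 \<alpha>\<close> is \<open>\<beta>(0, \<alpha>)\<close>.\<close>
definition beta0 :: "real \<Rightarrow> real" where
  "beta0 \<alpha> = 1 - exp (- \<alpha>)"

end

theory Submission imports Defs begin

text \<open>
  Let \<open>F j\<close> be the value of the first \<open>j\<close> greedy elements, \<open>m = k - 2\<close>, \<open>n = k - 1\<close>,
  \<open>q = 1 - 1/n\<close>, and let \<open>V\<close> be the value of the optimum after the removal of one element, so
  that it is attained by at most \<open>n\<close> elements. The greedy rule gives
  \<open>V - F (j + 1) \<le> q (V - F j)\<close>. Deleting one of the four duplicated elements costs nothing.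
  Deleting \<open>a i\<close> with \<open>i \<ge> 3\<close> costs at most the gain \<open>d\<close> of step \<open>i\<close>, and by submodularity the
  steps \<open>i - 2\<close>, \<open>i - 1\<close>, \<open>i\<close> each gained at least \<open>d\<close>. Hence
  \<open>V - F m + d \<le> q^(m-i) (q^(i-3) V - 3 d) + d \<le> q^(m-3) V\<close>, because \<open>3 q^(m-i) \<ge> 3/e \<ge> 1\<close>.
\<close>

section \<open>Marginal gains of submodular functions\<close>

lemma submodular_on_marginal_antimono:
  assumes "submodular_on N f" "S \<subseteq> T" "T \<subseteq> N" "x \<in> N" "x \<notin> T"
  shows "f (insert x T) - f T \<le> f (insert x S) - f S"
proof -
  have "f (insert x S \<union> T) + f (insert x S \<inter> T) \<le> f (insert x S) + f T"
    using assms unfolding submodular_on_def by blast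
  moreover have "insert x S \<union> T = insert x T" "insert x S \<inter> T = S"
    using assms by auto
  ultimately show ?thesis by simp
qed

text \<open>Add the elements of \<open>P\<close> one at a time: by diminishing returns each gains at
  most what it gains over \<open>S\<close>, hence at most \<open>d\<close>. Elements already present
  gain 0, which \<open>0 \<le> d\<close> covers.\<close>

lemma submodular_on_union_le:
  assumes "submodular_on N f" "S \<subseteq> N" "finite P" "P \<subseteq> N"
    and gain: "\<And>x. x \<in> N - S \<Longrightarrow> f (insert x S) - f S \<le> d" and "0 \<le> d"
  shows "f (S \<union> P) \<le> f S + real (card P) * d"
  using assms(3,4)
proof (induction P rule: finite_induct)
  case empty
  then show ?case by simp
next
  case (insert x P)
  have step: "f (insert x (S \<union> P)) \<le> f (S \<union> P) + d"
  proof (cases "x \<in> S \<union> P")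
    case True
    then show ?thesis using \<open>0 \<le> d\<close> by (simp add: insert_absorb)
  next
    case False
    then show ?thesis
      using submodular_on_marginal_antimono[OF assms(1), of S "S \<union> P" x] gain[of x]
        insert.prems \<open>S \<subseteq> N\<close> by auto
  qed
  then show ?case
    using insert by (simp add: algebra_simps)
qed

text \<open>By diminishing returns \<open>x\<close> gains over \<open>A - {x}\<close> at most what
  it gains over \<open>{y}\<close>, which is 0.\<close>

lemma f_delete_with_copy:
  assumes "submodular_on N f" "mono_on (Pow N) f" "A \<subseteq> N" "x \<in> A" "y \<in> A" "y \<noteq> x"
    and "f {x, y} = f {y}"
  shows "f (A - {x}) = f A"
proof (rule antisym)
  show "f (A - {x}) \<le> f A"
    using assms by (intro mono_onD[OF assms(2)]) auto
  have "f (insert x (A - {x})) - f (A - {x}) \<le> f (insert x {y}) - f {y}"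
    using assms by (intro submodular_on_marginal_antimono[of N]) auto
  then show "f A \<le> f (A - {x})"
    using assms by (simp add: insert_absorb)
qed

section \<open>Robust value under one deletion\<close>

lemma robust_value_1_ge:
  assumes "finite A" "c \<le> f A" "\<And>z. z \<in> A \<Longrightarrow> c \<le> f (A - {z})"
  shows "c \<le> robust_value 1 f A"
proof -
  have "c \<le> f (A - Z)" if "Z \<subseteq> A" "card Z \<le> 1" for Z
  proof -
    have "finite Z" using that assms finite_subset by blast
    then consider "Z = {}" | z where "Z = {z}"
      using \<open>card Z \<le> 1\<close> by (metis card_0_eq card_1_singletonE le_eq_less_or_eq less_one)
    then show ?thesis using assms that by cases auto
  qed
  moreover have "finite {Z. Z \<subseteq> A \<and> card Z \<le> 1}"
    using assms by simp
  moreover have "{} \<in> {Z. Z \<subseteq> A \<and> card Z \<le> 1}" by simp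
  ultimately show ?thesis
    unfolding robust_value_def by (subst Min_ge_iff) auto
qed

text \<open>This replaces the robust value of an optimum by the plain value of a set with one
  element fewer, to which the greedy analysis applies.\<close>

lemma robust_value_1_le_remove:
  assumes "finite S" "card S \<le> Suc n"
  obtains P where "P \<subseteq> S" "card P \<le> n" "robust_value 1 f S \<le> f P"
proof -
  have le: "robust_value 1 f S \<le> f (S - Z)" if "Z \<subseteq> S" "card Z \<le> 1" for Z
    unfolding robust_value_def using assms that by (intro Min_le) auto
  show ?thesis
  proof (cases "S = {}")
    case True
    then show ?thesis using le[of "{}"] that by simp
  next
    case False
    then obtain x where "x \<in> S" by blast
    then show ?thesis using le[of "{x}"] that[of "S - {x}"] assms by auto
  qed
qed

section \<open>The greedy sequence and its gains\<close>

lemma greedy_seq_in: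
  assumes "greedy_seq N f m a" "i < m"
  shows "a (Suc i) \<in> N - a ` {1..i}"
proof -
  have "Suc i \<in> {1..m}" using assms(2) by simp
  then have "a (Suc i) \<in> N - a ` {1..<Suc i}"
    using assms(1) unfolding greedy_seq_def is_arg_max_def by blast
  then show ?thesis by (simp only: atLeastLessThanSuc_atLeastAtMost)
qed

lemma greedy_seq_max:
  assumes "greedy_seq N f m a" "i < m" "x \<in> N - a ` {1..i}"
  shows "f (insert x (a ` {1..i})) \<le> f (a ` {1..Suc i})"
proof -
  have "is_arg_max (\<lambda>x. f (insert x (a ` {1..i})) - f (a ` {1..i}))
     (\<lambda>x. x \<in> N - a ` {1..i}) (a (Suc i))"
    using bspec[OF assms(1)[unfolded greedy_seq_def], of "Suc i"] assms(2)
    by (simp add: atLeastLessThanSuc_atLeastAtMost)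
  moreover have "a ` {1..Suc i} = insert (a (Suc i)) (a ` {1..i})"
    by (simp add: atLeastAtMostSuc_conv)
  ultimately show ?thesis
    using assms(3) unfolding is_arg_max_linorder by fastforce
qed

lemma greedy_seq_subset:
  assumes "greedy_seq N f m a" "i \<le> m"
  shows "a ` {1..i} \<subseteq> N"
proof
  fix x assume "x \<in> a ` {1..i}"
  then obtain j where "x = a (Suc j)" "j < m"
    using assms(2) by (auto simp: image_iff) (metis Suc_le_D Suc_le_eq order.trans)
  then show "x \<in> N" using greedy_seq_in[OF assms(1)] by blast
qed

text \<open>The later element was already available one step earlier. By submodularity it would have
  gained at least as much there, and the greedy choice gained no less.\<close>

lemma greedy_seq_gain_antimono:
  assumes "greedy_seq N f m a" "submodular_on N f" "Suc i < m"
  shows "f (a ` {1..Suc (Suc i)}) - f (a ` {1..Suc i}) \<le> f (a ` {1..Suc i}) - f (a ` {1..i})"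
proof -
  let ?S = "\<lambda>j. a ` {1..j}" and ?x = "a (Suc (Suc i))"
  have x: "?x \<in> N - ?S (Suc i)"
    using greedy_seq_in[OF assms(1,3)] .
  have "f (insert ?x (?S (Suc i))) - f (?S (Suc i)) \<le> f (insert ?x (?S i)) - f (?S i)"
    using assms x greedy_seq_subset[OF assms(1), of "Suc i"]
    by (intro submodular_on_marginal_antimono[OF assms(2)]) auto
  moreover have "insert ?x (?S (Suc i)) = ?S (Suc (Suc i))"
    by (simp add: atLeastAtMostSuc_conv)
  moreover have "?x \<in> N - ?S i" using x by auto
  then have "f (insert ?x (?S i)) \<le> f (?S (Suc i))"
    using greedy_seq_max[OF assms(1)] assms(3) by simp
  ultimately show ?thesis by simp
qed

text \<open>Adding all of \<open>P\<close> to the greedy prefix reaches at least \<open>f P\<close>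
  by monotonicity, and each of its at most \<open>n\<close> elements contributes at most the next
  greedy gain.\<close>

lemma greedy_seq_gap_le:
  assumes "finite N" "mono_on (Pow N) f" "submodular_on N f" "greedy_seq N f m a" "i < m"
    and "P \<subseteq> N" "card P \<le> n"
  shows "f P - f (a ` {1..i}) \<le> real n * (f (a ` {1..Suc i}) - f (a ` {1..i}))"
proof -
  let ?S = "\<lambda>j. a ` {1..j}"
  let ?d = "f (?S (Suc i)) - f (?S i)"
  have sub: "?S i \<subseteq> N" "?S (Suc i) \<subseteq> N"
    using greedy_seq_subset[OF assms(4)] assms(5) by auto
  have d: "0 \<le> ?d"
    using sub mono_onD[OF assms(2), of "?S i" "?S (Suc i)"] by (auto simp: image_mono)
  have "f P \<le> f (?S i \<union> P)"
    using sub assms by (intro mono_onD[OF assms(2)]) auto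
  also have "\<dots> \<le> f (?S i) + real (card P) * ?d"
    using assms sub d greedy_seq_max[OF assms(4,5)] finite_subset
    by (intro submodular_on_union_le[OF assms(3)]) auto
  also have "\<dots> \<le> f (?S i) + real n * ?d"
    using d assms by (intro add_left_mono mult_right_mono) auto
  finally show ?thesis by simp
qed

section \<open>Numerical estimates and the limit\<close>

text \<open>With \<open>p = n - 1\<close> the base is \<open>1 / (1 + 1/p)\<close>, so its
  \<open>p\<close>-th power is at least 1/e, hence at least 1/3. Smaller exponents only increase the
  power.\<close>

lemma one_minus_inverse_power_ge_third:
  assumes "j < n"
  shows "1 \<le> 3 * (1 - 1 / real n) ^ j"
proof (cases "n = 1")
  case True
  then show ?thesis using assms by simp
next
  case False
  define p where "p = n - 1"
  have p: "real n = real p + 1" "0 < p" "j \<le> p"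
    using assms False by (auto simp: p_def)
  have "(1 + 1 / real p) ^ p \<le> exp (1 / real p) ^ p"
    by (intro power_mono exp_ge_add_one_self) auto
  also have "\<dots> = exp 1"
    using p by (simp flip: exp_of_nat_mult)
  finally have "(1 + 1 / real p) ^ p \<le> 3"
    using exp_le by linarith
  moreover have "1 - 1 / real n = 1 / (1 + 1 / real p)"
    using p by (simp add: field_simps)
  then have "(1 - 1 / real n) ^ p = 1 / (1 + 1 / real p) ^ p"
    by (simp only: power_one_over)
  moreover have "0 < (1 + 1 / real p) ^ p"
    by (simp add: add_pos_nonneg)
  ultimately have "1 \<le> 3 * (1 - 1 / real n) ^ p"
    by (simp add: pos_le_divide_eq)
  also have "\<dots> \<le> 3 * (1 - 1 / real n) ^ j"
    using p by (intro mult_left_mono power_decreasing) auto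
  finally show ?thesis .
qed

lemma geometric_decay:
  fixes D :: "nat \<Rightarrow> real"
  assumes "0 \<le> q" "i \<le> j" "\<And>l. i \<le> l \<Longrightarrow> l < j \<Longrightarrow> D (Suc l) \<le> q * D l"
  shows "D j \<le> q ^ (j - i) * D i"
  using assms(2,3)
proof (induction j rule: dec_induct)
  case base
  then show ?case by simp
next
  case (step j)
  have "D (Suc j) \<le> q * D j" using step by simp
  also have "\<dots> \<le> q * (q ^ (j - i) * D i)"
    using step assms(1) by (intro mult_left_mono) auto
  finally show ?case using step by (simp add: Suc_diff_le)
qed

lemma value_minus_gain_ge:
  fixes F :: "nat \<Rightarrow> real"
  assumes "F 0 = 0" "0 < n" "m < n" "3 \<le> i" "i \<le> m"
    and gap: "\<And>j. j < m \<Longrightarrow> V - F j \<le> real n * (F (Suc j) - F j)"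
    and anti: "\<And>j. Suc j < m \<Longrightarrow> F (Suc (Suc j)) - F (Suc j) \<le> F (Suc j) - F j"
    and "0 \<le> F i - F (i - 1)"
  shows "(1 - (1 - 1 / real n) ^ (m - 3)) * V \<le> F m - (F i - F (i - 1))"
proof -
  define q where "q = 1 - 1 / real n"
  define d where "d = F i - F (i - 1)"
  define l where "l = i - 3"
  have i: "i = Suc (Suc (Suc l))" using assms by (simp add: l_def)
  have q: "0 \<le> q" using assms by (simp add: q_def)
  have decay: "V - F (Suc j) \<le> q * (V - F j)" if "j < m" for j
    using gap[OF that] \<open>0 < n\<close> by (simp add: q_def field_simps)
  have "V - F l \<le> q ^ l * V"
    using geometric_decay[OF q, of 0 l "\<lambda>j. V - F j"] decay assms i by simp
  \<comment> \<open>The difference telescopes into three gains; the last is \<open>d\<close> and the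
    two before it are at least as large.\<close>
  moreover have "3 * d \<le> F i - F l"
    using anti[of l] anti[of "Suc l"] \<open>i \<le> m\<close> unfolding d_def i by simp
  ultimately have Fi: "V - F i \<le> q ^ l * V - 3 * d" by linarith
  have "V - F m \<le> q ^ (m - i) * (V - F i)"
    using geometric_decay[OF q, of i m "\<lambda>j. V - F j"] decay assms by simp
  also have "\<dots> \<le> q ^ (m - i) * (q ^ l * V - 3 * d)"
    using Fi q by (intro mult_left_mono) auto
  also have "\<dots> = q ^ (m - i + l) * V - 3 * q ^ (m - i) * d"
    by (simp add: algebra_simps power_add)
  also have "m - i + l = m - 3" using assms i by simp
  finally have "V - F m \<le> q ^ (m - 3) * V - 3 * q ^ (m - i) * d" .
  \<comment> \<open>The surplus of three gains, even after decaying over the remaining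
    \<open>m - i < n\<close> steps, still pays for the loss \<open>d\<close>.\<close>
  moreover have "1 * d \<le> 3 * q ^ (m - i) * d"
    using one_minus_inverse_power_ge_third[of "m - i" n] assms
    by (intro mult_right_mono) (auto simp: q_def d_def)
  ultimately show ?thesis
    unfolding q_def[symmetric] d_def[symmetric] by (simp add: algebra_simps)
qed

text \<open>This is \<open>1 - x \<le> exp (- x)\<close> at \<open>x = 1/n\<close>, raised to the
  power \<open>j\<close>.\<close>

lemma beta0_le_geometric:
  assumes "0 < n"
  shows "beta0 (real j / real n) \<le> 1 - (1 - 1 / real n) ^ j"
proof -
  have "(1 - 1 / real n) ^ j \<le> exp (- (1 / real n)) ^ j"
    using assms exp_ge_add_one_self[of "- (1 / real n)"] by (intro power_mono) auto
  also have "\<dots> = exp (- (real j / real n))"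
    by (simp flip: exp_of_nat_mult)
  finally show ?thesis by (simp add: beta0_def)
qed

lemma beta0_tendsto:
  "(\<lambda>n::nat. beta0 ((real n - 5) / (real n - 1))) \<longlonglongrightarrow> 1 - 1 / exp 1"
proof -
  have "(\<lambda>n. 1 - 4 / (real n - 1)) \<longlonglongrightarrow> 1 - 0"
    by (intro tendsto_intros tendsto_divide_0[OF tendsto_const] filterlim_at_top_imp_at_infinity
        filterlim_tendsto_add_at_top[of "\<lambda>_. - 1" "- 1" _ real, simplified] filterlim_real_sequentially)
  \<comment> \<open>The identity fails at \<open>n = 1\<close>, where division by zero yields
    0.\<close>
  moreover have "\<forall>\<^sub>F n in sequentially. 1 - 4 / (real n - 1) = (real n - 5) / (real n - 1)"
    using eventually_gt_at_top[of 1] by eventually_elim (simp add: field_simps)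
  ultimately have "(\<lambda>n. (real n - 5) / (real n - 1)) \<longlonglongrightarrow> 1"
    using tendsto_cong by force
  then have "(\<lambda>n. beta0 ((real n - 5) / (real n - 1))) \<longlonglongrightarrow> 1 - exp (- 1)"
    unfolding beta0_def by (intro tendsto_intros)
  then show ?thesis by (simp add: exp_minus field_simps)
qed

theorem theorem6:
  fixes N :: "'a set" and f :: "'a set \<Rightarrow> real" and k :: nat
    and a :: "nat \<Rightarrow> 'a" and a1' a2' :: 'a and A OPT :: "'a set"
  assumes "finite N"
    and "mono_on (Pow N) f"
    and "submodular_on N f"
    and "f {} = 0"
    and "k \<ge> 4"
    and "\<forall>x\<in>N. \<exists>x'\<in>N. is_copy f x x'"
    and "greedy_seq N f (k - 2) a"
    and "a1' \<in> N" and "is_copy f (a 1) a1'"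
    and "a2' \<in> N" and "is_copy f (a 2) a2'"
    and "A = {a 1, a1', a 2, a2'} \<union> a ` {3..k - 2}"
    and "is_OPT f k N 1 OPT"
  shows "robust_value 1 f A \<ge> beta0 ((real k - 5) / (real k - 1)) * robust_value 1 f OPT
    \<and> (\<lambda>n::nat. beta0 ((real n - 5) / (real n - 1))) \<longlonglongrightarrow> 1 - 1 / exp 1"
proof (intro conjI beta0_tendsto)
  note mono = mono_onD[OF assms(2)]
  have nonneg: "0 \<le> f S" if "S \<subseteq> N" for S
    using mono[of "{}" S] that assms(4) by simp
  have robust_nonneg: "0 \<le> robust_value 1 f S" if "S \<subseteq> N" for S
    using that finite_subset[OF that \<open>finite N\<close>] by (intro robust_value_1_ge nonneg) auto
  define m where "m = k - 2"
  define n where "n = k - 1"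
  note greedy = assms(7)[folded m_def]
  define F where "F = (\<lambda>j. f (a ` {1..j}))"
  have "{1..m} = {1, 2} \<union> {3..m}" using \<open>k \<ge> 4\<close> by (auto simp: m_def)
  then have A: "A = {a1', a2'} \<union> a ` {1..m}"
    using assms(12) by (auto simp: m_def)
  have AN: "A \<subseteq> N"
    using greedy_seq_subset[OF greedy, of m] assms(8,10) A by simp
  have OPT: "OPT \<subseteq> N" "card OPT \<le> k"
    using assms(13) by (auto simp: is_OPT_def is_arg_max_def)
  show "beta0 ((real k - 5) / (real k - 1)) * robust_value 1 f OPT \<le> robust_value 1 f A"
  \<comment> \<open>For \<open>k = 4\<close> the argument of \<open>beta0\<close> is -1/3, so the
    bound is at most 0. This case is separate because only two greedy steps exist and
    \<open>m - 3\<close> would be truncated.\<close>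
  proof (cases "k = 4")
    case True
    then have "beta0 ((real k - 5) / (real k - 1)) \<le> 0"
      by (simp add: beta0_def)
    then show ?thesis
      using robust_nonneg[OF AN] robust_nonneg[OF OPT(1)] mult_nonpos_nonneg order_trans by blast
  next
    case False
    then have k: "3 \<le> m" "m < n" "0 < n" "real k - 1 = real n" "real k - 5 = real (m - 3)"
      using \<open>k \<ge> 4\<close> by (auto simp: m_def n_def)
    have "finite OPT" "card OPT \<le> Suc n"
      using OPT finite_subset[OF _ \<open>finite N\<close>] by (auto simp: n_def)
    then obtain P where P: "P \<subseteq> OPT" "card P \<le> n" "robust_value 1 f OPT \<le> f P"
      by (rule robust_value_1_le_remove)
    have PN: "P \<subseteq> N" using P OPT by blast
    have gain: "0 \<le> F (Suc j) - F j" if "j < m" for j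
      using mono[of "a ` {1..j}" "a ` {1..Suc j}"] that greedy_seq_subset[OF greedy]
      by (auto simp: F_def image_mono)
    have main: "(1 - (1 - 1 / real n) ^ (m - 3)) * f P \<le> F m - (F i - F (i - 1))"
      if "3 \<le> i" "i \<le> m" for i
    proof (rule value_minus_gain_ge[OF _ k(3,2) that])
      show "F 0 = 0" using assms(4) by (simp add: F_def)
      show "f P - F j \<le> real n * (F (Suc j) - F j)" if "j < m" for j
        using greedy_seq_gap_le[OF assms(1-3) greedy that PN P(2)] by (simp add: F_def)
      show "F (Suc (Suc j)) - F (Suc j) \<le> F (Suc j) - F j" if "Suc j < m" for j
        using greedy_seq_gain_antimono[OF greedy assms(3) that] by (simp add: F_def)
      show "0 \<le> F i - F (i - 1)"
        using gain[of "i - 1"] that by simp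
    qed
    define c where "c = (1 - (1 - 1 / real n) ^ (m - 3)) * f P"
    have "F m \<le> f A"
      unfolding F_def using A AN by (intro mono) auto
    moreover have "c \<le> F m"
      using main[of m] gain[of "m - 1"] k by (simp add: c_def)
    ultimately have fA: "c \<le> f A" by simp
    have "c \<le> f (A - {z})" if "z \<in> A" for z
    \<comment> \<open>A copy \<open>a1'\<close> or \<open>a2'\<close> may coincide with a later
      greedy element; it then falls under the first case, where deletion is free.\<close>
    proof (cases "z \<in> {a 1, a1', a 2, a2'}")
      case True
      \<comment> \<open>Since \<open>f {x} = f {x'} = f {x, x'}\<close>, the relation is symmetric
        and either member of the pair can be deleted.\<close>
      have copy: "f (A - {x}) = f A" "f (A - {x'}) = f A"
        if "x \<in> A" "x' \<in> A" "is_copy f x x'" for x x'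
        using f_delete_with_copy[OF assms(3,2) AN, of x x']
          f_delete_with_copy[OF assms(3,2) AN, of x' x] that
        by (auto simp: is_copy_def insert_commute)
      have "f (A - {z}) = f A"
        using True copy[of "a 1" a1'] copy[of "a 2" a2'] assms(9,11,12) by blast
      then show ?thesis using fA by simp
    next
      case False
      then obtain i where i: "z = a i" "3 \<le> i" "i \<le> m"
        using \<open>z \<in> A\<close> assms(12) by (auto simp: m_def)
      define j where "j = i - 1"
      have j: "i = Suc j" "j < m" using i by (auto simp: j_def)
      \<comment> \<open>Greedy elements are distinct, so the prefix before \<open>a i\<close>
        survives its deletion; by submodularity the loss is at most the greedy gain of
        \<open>a i\<close>.\<close>
      have "a i \<notin> a ` {1..j}"
        using greedy_seq_in[OF greedy j(2)] j(1) by simp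
      moreover have "a ` {1..j} \<subseteq> A"
        using A j(2) by auto
      ultimately have "f (insert (a i) (A - {a i})) - f (A - {a i})
          \<le> f (insert (a i) (a ` {1..j})) - f (a ` {1..j})"
        using AN i(1) \<open>z \<in> A\<close> by (intro submodular_on_marginal_antimono[OF assms(3)]) blast+
      also have "insert (a i) (A - {a i}) = A"
        using i \<open>z \<in> A\<close> by auto
      also have "insert (a i) (a ` {1..j}) = a ` {1..i}"
        using j by (simp add: atLeastAtMostSuc_conv)
      finally have "f A - f (A - {z}) \<le> F i - F (i - 1)"
        using i j by (simp add: F_def)
      then show ?thesis
        using main[OF i(2,3)] \<open>F m \<le> f A\<close> by (simp add: c_def)
    qed
    then have "c \<le> robust_value 1 f A"
      using fA finite_subset[OF AN \<open>finite N\<close>] by (intro robust_value_1_ge)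
    \<comment> \<open>Both factors are bounded separately; this uses that the robust value and
      \<open>1 - (1 - 1/n)^(m - 3)\<close> are nonnegative.\<close>
    moreover have "beta0 (real (m - 3) / real n) * robust_value 1 f OPT \<le> c"
      unfolding c_def using P(3) robust_nonneg[OF OPT(1)] beta0_le_geometric[OF k(3)] k(3)
      by (intro mult_mono) (auto intro!: power_le_one)
    ultimately show ?thesis using k by simp
  qed
qed

end
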